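(* Let $G=(V,E)$ be a directed graph (without latent variables) and let $e\in E$ be an edge with $\mathcal{M}^{p}_{G,e}\neq\emptyset$. Define $G'=(V,E\setminus\{e\})$. If there exist $V_i,V_j\in V$ such that $$\operatorname{An}_{G'}(V_i)\cap\operatorname{An}_{G'}(V_j)=\emptyset\neq\operatorname{An}_G(V_i)\cap\operatorname{An}_G(V_j),$$ then the sign of the edge $e$ in $G$ is identifiable.
   Context: Let $PD_d$ be the set of symmetric positive definite real $d\times d$ matrices and $PDD_d\subset PD_d$ the set of diagonal ones. $G=(V,E)$ is a finite directed graph with $V=\{V_1,\dots,V_d\}$; cycles and self-loops are allowed. $\operatorname{An}_G(V_i)$ is the set of all $V_k$ from which there is a directed path with at least one edge to $V_i$ (so $V_i\in \operatorname{An}_G(V_i)$ iff $V_i$ lies on a directed cycle, a self-loop counting as a cycle). For $A\in\mathbb{R}^{d\times d}$ the entry $A_{ij}$ corresponds to the edge $e=(V_j,V_i)$, i.e. $V_j\to V_i$, and we write $A_e:=A_{ij}$; $\operatorname{supp}(A)$ is the set of edges $(V_j,V_i)$ with $A_{ij}\neq 0$. The set of $t$-faithful covariance matrices is $$F_G:=\{\Sigma\in PD_d:\ \forall V_i,V_j\in V,\ \operatorname{An}_G(V_i)\cap\operatorname{An}_G(V_j)=\emptyset\iff\Sigma_{ij}=0\}.$$ For $k\in\{+,-\}$, $$\mathcal{M}^{k}_{G,e}:=\{\Sigma\in F_G:\exists A\in\mathbb{R}^{d\times d},\,D\in PDD_d \text{ with } A\Sigma+\Sigma A^T=-D,\ \operatorname{supp}(A)=E,\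 \operatorname{sign}(A_e)=k\},$$ and $\mathcal{M}^{p}_{G,e}:=\mathcal{M}^{+}_{G,e}\cup\mathcal{M}^{-}_{G,e}$. The sign of $e$ in $G$ is called identifiable if $\mathcal{M}^{+}_{G,e}\cap\mathcal{M}^{-}_{G,e}=\emptyset$ and at least one of $\mathcal{M}^{+}_{G,e},\mathcal{M}^{-}_{G,e}$ is non-empty. "Without latent variables" means that the whole matrix $\Sigma$ is observed, so that this definition applies directly. *)

theory Defs
  imports "HOL-Analysis.Analysis"
begin

text \<open>
  The vertex set is the finite index type \<open>'n\<close>, with d = CARD('n), and a directed graph
  on it is its edge relation \<open>E :: 'n rel\<close>, where \<open>(u, v) \<in> E\<close> means u \<open>\<rightarrow>\<close> v.
  Cycles and self-loops are allowed.
\<close>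

definition PD :: "(real ^ 'n::finite ^ 'n) set" where
  "PD = {S. transpose S = S \<and> (\<forall>x. x \<noteq> 0 \<longrightarrow> x \<bullet> (S *v x) > 0)}"

definition PDD :: "(real ^ 'n::finite ^ 'n) set" where
  "PDD = {D \<in> PD. \<forall>i j. i \<noteq> j \<longrightarrow> D $ i $ j = 0}"

text \<open>
  The transitive closure is not reflexive: a vertex is its own ancestor only if it lies on a
  directed cycle (possibly a self-loop).
\<close>
definition An :: "'n rel \<Rightarrow> 'n \<Rightarrow> 'n set" where
  "An E v = {u. (u, v) \<in> E\<^sup>+}"

text \<open>Row index = head, column index = tail: the edge \<open>j \<rightarrow> i\<close> carries the entry \<open>A $ i $ j\<close>.\<close>
definition edge_entry :: "real ^ 'n ^ 'n \<Rightarrow> 'n \<times> 'n \<Rightarrow> real" where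
  "edge_entry A e = A $ snd e $ fst e"

definition supp :: "real ^ 'n ^ 'n \<Rightarrow> 'n rel" where
  "supp A = {e. edge_entry A e \<noteq> 0}"

definition faithful_cov :: "'n::finite rel \<Rightarrow> (real ^ 'n ^ 'n) set" where
  "faithful_cov E = {S \<in> PD. \<forall>i j. An E i \<inter> An E j = {} \<longleftrightarrow> S $ i $ j = 0}"

text \<open>The sign parameter \<open>k\<close> is \<open>1\<close> for + and \<open>-1\<close> for -.\<close>
definition M_sign :: "real \<Rightarrow> 'n::finite rel \<Rightarrow> 'n \<times> 'n \<Rightarrow> (real ^ 'n ^ 'n) set" where
  "M_sign k E e = {S \<in> faithful_cov E. \<exists>A. \<exists>D \<in> PDD.
     A ** S + S ** transpose A = - D \<and> supp A = E \<and> sgn (edge_entry A e) = k}"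

definition M_plus :: "'n::finite rel \<Rightarrow> 'n \<times> 'n \<Rightarrow> (real ^ 'n ^ 'n) set" where
  "M_plus E e = M_sign 1 E e"

definition M_minus :: "'n::finite rel \<Rightarrow> 'n \<times> 'n \<Rightarrow> (real ^ 'n ^ 'n) set" where
  "M_minus E e = M_sign (-1) E e"

definition M_p :: "'n::finite rel \<Rightarrow> 'n \<times> 'n \<Rightarrow> (real ^ 'n ^ 'n) set" where
  "M_p E e = M_plus E e \<union> M_minus E e"

definition sign_identifiable :: "'n::finite rel \<Rightarrow> 'n \<times> 'n \<Rightarrow> bool" where
  "sign_identifiable E e \<longleftrightarrow>
     M_plus E e \<inter> M_minus E e = {} \<and> (M_plus E e \<noteq> {} \<or> M_minus E e \<noteq> {})"

end

theory Submission
  imports Defs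
begin

text \<open>
  Suppose \<open>S\<close> lies in both sign classes, with solutions \<open>A1\<close> and \<open>A2\<close> of the Lyapunov equation
  whose entries at \<open>e\<close> have opposite signs. The equation is linear in the pair \<open>(A, D)\<close>, and the
  admissible \<open>D\<close> form a convex cone; so some positive combination of \<open>A1\<close> and \<open>A2\<close> has entry
  zero at \<open>e\<close> and still solves the equation, with the same \<open>S\<close> and an admissible \<open>D\<close>. Its support
  lies in the graph without \<open>e\<close>. In that graph \<open>i\<close> and \<open>j\<close> have no common ancestor, and this
  forces \<open>S $ i $ j = 0\<close> (lemma \<open>no_common_ancestor_imp_zero_cov\<close>). But \<open>S\<close> is faithful to the
  full graph, where \<open>i\<close> and \<open>j\<close> do have a common ancestor, so \<open>S $ i $ j \<noteq> 0\<close>.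

  The usual reason for the vanishing covariance is the formula
  \<open>S = \<integral> exp (t A) D exp (t A\<^sup>T) dt\<close>. The proof below is algebraic instead. The vectors supported
  on the ancestral closure of \<open>i\<close> form a subspace invariant under \<open>A\<^sup>T\<close>, and likewise for \<open>j\<close>.
  The lemma \<open>orthogonal_invariant_subspaces\<close> shows that two such subspaces are orthogonal for
  the inner product given by \<open>S\<close>, by examining a pair of vectors that maximises the correlation
  between the two.
\<close>

section \<open>Orthogonality of dissipative invariant subspaces\<close>

lemma linear_coeff_zero_if_nonneg:
  fixes b c :: real
  assumes "\<And>t. 0 \<le> t * b + t\<^sup>2 * c"
  shows "b = 0"
proof (rule ccontr)
  assume "b \<noteq> 0"
  define k where "k = \<bar>c\<bar> + 1"
  have k: "k > 0" "c < k" by (auto simp: k_def)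
  have "0 \<le> (- b / k) * b + (- b / k)\<^sup>2 * c" by (rule assms)
  also have "\<dots> = b\<^sup>2 / k\<^sup>2 * (c - k)"
    using k by (simp add: field_simps power2_eq_square)
  also have "\<dots> < 0"
    using k \<open>b \<noteq> 0\<close> by (intro mult_pos_neg) auto
  finally show False by simp
qed

text \<open>
  Here \<open>S\<close> defines an inner product for which \<open>T\<close> is strictly dissipative on \<open>U\<close> and on \<open>W\<close>.
  Let \<open>c\<close> be the maximum over \<open>U \<times> W\<close> of the Rayleigh quotient of the inner product of \<open>u\<close> and \<open>w\<close>
  against the sum of their squared norms. At a maximiser \<open>(p, q)\<close> the derivative vanishes in every
  direction of \<open>U \<times> W\<close>, in particular in the direction \<open>(T p, T q)\<close>. That derivative
  evaluates the cross term \<open>T p \<bullet> S q + p \<bullet> S (T q)\<close>, which is zero, as \<open>2 * c\<close> times a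
  negative number. Hence \<open>c = 0\<close>. This replaces the uniqueness theorem for Sylvester equations
  with stable coefficients.
\<close>
lemma orthogonal_invariant_subspaces:
  fixes S T :: "'a::euclidean_space \<Rightarrow> 'a"
  assumes lin: "linear S"
    and sym: "\<And>x y. x \<bullet> S y = y \<bullet> S x"
    and pos: "\<And>x. x \<noteq> 0 \<Longrightarrow> x \<bullet> S x > 0"
    and U: "subspace U" and W: "subspace W"
    and TU: "\<And>u. u \<in> U \<Longrightarrow> T u \<in> U" and TW: "\<And>w. w \<in> W \<Longrightarrow> T w \<in> W"
    and dissU: "\<And>u. u \<in> U \<Longrightarrow> u \<noteq> 0 \<Longrightarrow> T u \<bullet> S u < 0"
    and dissW: "\<And>w. w \<in> W \<Longrightarrow> w \<noteq> 0 \<Longrightarrow> T w \<bullet> S w < 0"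
    and cross: "\<And>u w. u \<in> U \<Longrightarrow> w \<in> W \<Longrightarrow> T u \<bullet> S w + u \<bullet> S (T w) = 0"
    and u: "u \<in> U" and w: "w \<in> W"
  shows "u \<bullet> S w = 0"
proof (cases "u = 0 \<and> w = 0")
  case True
  then show ?thesis by simp
next
  case False
  define s where "s x y = x \<bullet> S y" for x y
  have s_add: "s (x + y) z = s x z + s y z" "s z (x + y) = s z x + s z y"
    and s_scale: "s (r *\<^sub>R x) y = r * s x y" "s x (r *\<^sub>R y) = r * s x y" for x y z r
    using lin by (simp_all add: s_def inner_left_distrib inner_right_distrib linear_add linear_scale)
  have s_sym: "s x y = s y x" for x y unfolding s_def by (rule sym)
  have s_nonneg: "s x x \<ge> 0" for x
    using pos[of x] by (cases "x = 0") (auto simp: s_def)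
  define g where "g z = s (fst z) (fst z) + s (snd z) (snd z)" for z
  have g_pos: "g z > 0" if "z \<noteq> 0" for z
  proof (cases "fst z = 0")
    case True
    then have "snd z \<noteq> 0" using that by (simp add: prod_eq_iff)
    then show ?thesis using pos[of "snd z"] s_nonneg[of "fst z"] by (simp add: g_def s_def)
  next
    case False
    then show ?thesis using pos[of "fst z"] s_nonneg[of "snd z"] by (simp add: g_def s_def)
  qed
  define K where "K = sphere (0::'a \<times> 'a) 1 \<inter> (U \<times> W)"
  have "compact K"
    unfolding K_def using U W
    by (intro compact_Int_closed closed_Times closed_subspace) auto
  define N where "N z = (1 / norm z) *\<^sub>R z" for z :: "'a \<times> 'a"
  have N_in: "N z \<in> K" if "z \<in> U \<times> W" "z \<noteq> 0" for z
    using that U W by (auto simp: K_def N_def mem_Times_iff subspace_scale)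
  have "K \<noteq> {}"
    using N_in[of "(u, w)"] u w False by (auto simp: zero_prod_def)
  define \<phi> where "\<phi> z = s (fst z) (snd z) / g z" for z
  have "continuous_on K \<phi>"
  proof -
    have "g z \<noteq> 0" if "z \<in> K" for z
    proof -
      have "norm z = 1" using that by (simp add: K_def)
      then have "z \<noteq> 0" by auto
      from g_pos[OF this] show ?thesis by simp
    qed
    moreover have "continuous_on K (\<lambda>z. S (fst z))" "continuous_on K (\<lambda>z. S (snd z))"
      by (intro linear_continuous_on_compose[OF _ lin] continuous_intros)+
    ultimately show ?thesis
      unfolding \<phi>_def g_def s_def by (intro continuous_intros) auto
  qed
  from continuous_attains_sup[OF \<open>compact K\<close> \<open>K \<noteq> {}\<close> this]
  obtain p q where pq: "(p, q) \<in> K" and max: "\<And>z. z \<in> K \<Longrightarrow> \<phi> z \<le> \<phi> (p, q)"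
    by fastforce
  define c where "c = \<phi> (p, q)"
  have p: "p \<in> U" and q: "q \<in> W" and nz: "(p, q) \<noteq> 0"
    using pq by (auto simp: K_def)
  have bound: "s x y \<le> c * (s x x + s y y)" if "x \<in> U" "y \<in> W" for x y
  proof (cases "(x, y) = 0")
    case True
    then show ?thesis by (simp add: zero_prod_def s_def)
  next
    case False
    then have "\<phi> (N (x, y)) \<le> c"
      using max N_in that by (auto simp: c_def)
    moreover have "\<phi> (N (x, y)) = \<phi> (x, y)"
      using False by (simp add: \<phi>_def g_def N_def s_scale field_simps flip: distrib_left)
    ultimately show ?thesis
      using g_pos[OF False] by (simp add: \<phi>_def g_def pos_divide_le_eq)
  qed
  have attained: "s p q = c * (s p p + s q q)"
    using g_pos[OF nz] by (simp add: c_def \<phi>_def g_def)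
  have stat_p: "s a q = 2 * c * s a p" if "a \<in> U" for a
  proof -
    have "0 \<le> t * (2 * c * s a p - s a q) + t\<^sup>2 * (c * s a a)" for t
    proof -
      have "s (p + t *\<^sub>R a) q \<le> c * (s (p + t *\<^sub>R a) (p + t *\<^sub>R a) + s q q)"
        using p q that U by (intro bound) (auto simp: subspace_add subspace_scale)
      then show ?thesis
        using attained s_sym[of p a]
        by (simp add: s_add s_scale algebra_simps power2_eq_square)
    qed
    from linear_coeff_zero_if_nonneg[OF this] show ?thesis by simp
  qed
  have stat_q: "s p b = 2 * c * s b q" if "b \<in> W" for b
  proof -
    have "0 \<le> t * (2 * c * s b q - s p b) + t\<^sup>2 * (c * s b b)" for t
    proof -
      have "s p (q + t *\<^sub>R b) \<le> c * (s p p + s (q + t *\<^sub>R b) (q + t *\<^sub>R b))"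
        using p q that W by (intro bound) (auto simp: subspace_add subspace_scale)
      then show ?thesis
        using attained s_sym[of q b]
        by (simp add: s_add s_scale algebra_simps power2_eq_square)
    qed
    from linear_coeff_zero_if_nonneg[OF this] show ?thesis by simp
  qed
  have "0 = s (T p) q + s p (T q)"
    using cross[OF p q] by (simp add: s_def)
  also have "\<dots> = 2 * c * (s (T p) p + s (T q) q)"
    using stat_p[OF TU[OF p]] stat_q[OF TW[OF q]] by (simp add: algebra_simps)
  finally have "c * (s (T p) p + s (T q) q) = 0" by simp
  moreover have "s (T p) p + s (T q) q < 0"
  proof -
    have "s (T p) p \<le> 0" "s (T q) q \<le> 0"
      using dissU[OF p] dissW[OF q] linear_0[OF lin] by (fastforce simp: s_def)+
    moreover have "p \<noteq> 0 \<or> q \<noteq> 0" using nz by (auto simp: zero_prod_def)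
    ultimately show ?thesis
      using dissU[OF p] dissW[OF q] by (auto simp: s_def)
  qed
  ultimately have "c = 0" by simp
  \<comment> \<open>The maximum only bounds \<open>s\<close> from above; the bound from below comes from replacing \<open>u\<close> by \<open>- u\<close>.\<close>
  have "s u w \<le> 0" "s (- u) w \<le> 0"
    using bound[OF u w] bound[of "- u" w] u w U \<open>c = 0\<close> by (auto simp: subspace_neg)
  then show ?thesis by (simp add: s_def)
qed

section \<open>Zero covariance without common ancestors\<close>

lemma PD_diagonal_pos:
  assumes "D \<in> PD"
  shows "D $ i $ i > 0"
proof -
  have "axis i 1 \<bullet> (D *v axis i 1) > 0"
    using assms by (simp add: PD_def axis_eq_0_iff)
  then show ?thesis
    by (simp add: matrix_vector_mul_component inner_axis' inner_axis)
qed

lemma edge_in_graph: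
  assumes "supp A \<subseteq> E" "A $ m $ k \<noteq> 0"
  shows "(k, m) \<in> E"
  using assms by (auto simp: supp_def edge_entry_def)

text \<open>
  A vertex with no incoming edge has a zero row in \<open>A\<close>, so the diagonal entry of the left-hand
  side of the Lyapunov equation would be zero there.
\<close>
lemma lyapunov_ancestors_nonempty:
  fixes S A D :: "real ^ 'n::finite ^ 'n"
  assumes "D \<in> PDD"
    and eq: "A ** S + S ** transpose A = - D" and "supp A \<subseteq> E"
  shows "An E i \<noteq> {}"
proof
  assume "An E i = {}"
  then have "A $ i $ k = 0" for k
    using edge_in_graph[OF assms(3)] by (force simp: An_def)
  then have "(A ** S + S ** transpose A) $ i $ i = 0"
    by (simp add: matrix_matrix_mult_def transpose_def)
  with eq PD_diagonal_pos[of D i] assms(1) show False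
    by (simp add: PDD_def)
qed

text \<open>
  The ancestral closures \<open>P\<close> and \<open>Q\<close> must contain \<open>i\<close> and \<open>j\<close> themselves, whereas \<open>An\<close> is
  not reflexive. They are still disjoint: if, say, \<open>i\<close> is an ancestor of \<open>j\<close>, then every ancestor
  of \<open>i\<close>, of which there is at least one, is also an ancestor of \<open>j\<close>.
\<close>
lemma no_common_ancestor_imp_zero_cov:
  fixes S A D :: "real ^ 'n::finite ^ 'n"
  assumes S: "S \<in> PD" and D: "D \<in> PDD"
    and eq: "A ** S + S ** transpose A = - D" and supp: "supp A \<subseteq> E"
    and disj: "An E i \<inter> An E j = {}"
  shows "S $ i $ j = 0"
proof -
  define P Q where "P = insert i (An E i)" and "Q = insert j (An E j)"
  have PQ: "P \<inter> Q = {}"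
  proof -
    have An_trans: "An E k \<subseteq> An E m" if "k \<in> An E m" for k m
      using that by (auto simp: An_def intro: trancl_trans)
    have nonempty: "An E k \<noteq> {}" for k
      by (rule lyapunov_ancestors_nonempty[OF D eq supp])
    have "i \<notin> An E j" "j \<notin> An E i" "i \<noteq> j"
      using An_trans[of i j] An_trans[of j i] nonempty[of i] nonempty[of j] disj by blast+
    then show ?thesis
      using disj by (auto simp: P_def Q_def)
  qed
  define V where "V R = {x :: real ^ 'n. \<forall>k. k \<notin> R \<longrightarrow> x $ k = 0}" for R
  have V: "subspace (V R)" for R
    by (auto simp: subspace_def V_def)
  have invariant: "transpose A *v x \<in> V (insert r (An E r))" if "x \<in> V (insert r (An E r))" for x r
  proof -
    have "A $ m $ k * x $ m = 0" if "k \<notin> insert r (An E r)" for k m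
    proof (rule ccontr)
      assume nz: "A $ m $ k * x $ m \<noteq> 0"
      then have "(k, m) \<in> E" using edge_in_graph[OF supp] by simp
      moreover have "m \<in> insert r (An E r)"
        using nz \<open>x \<in> _\<close> unfolding V_def by force
      ultimately show False
        using that by (auto simp: An_def dest: trancl_into_trancl2)
    qed
    then show ?thesis
      unfolding V_def matrix_vector_mult_def transpose_def
      by (auto intro!: sum.neutral)
  qed
  have sym: "x \<bullet> (S *v y) = y \<bullet> (S *v x)" for x y
    using S dot_lmul_matrix[of x S y]
    by (simp add: PD_def inner_commute transpose_matrix_vector[symmetric])
  \<comment> \<open>The Lyapunov equation as an identity of bilinear forms.\<close>
  have form: "(transpose A *v x) \<bullet> (S *v y) + x \<bullet> (S *v (transpose A *v y)) = - (x \<bullet> (D *v y))"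
    for x y
  proof -
    have "(transpose A *v x) \<bullet> (S *v y) = x \<bullet> ((A ** S) *v y)"
      by (simp add: dot_lmul_matrix matrix_vector_mul_assoc[symmetric])
    moreover have "x \<bullet> (S *v (transpose A *v y)) = x \<bullet> ((S ** transpose A) *v y)"
      by (simp add: matrix_vector_mul_assoc del: transpose_matrix_vector)
    ultimately have "(transpose A *v x) \<bullet> (S *v y) + x \<bullet> (S *v (transpose A *v y))
        = x \<bullet> ((A ** S + S ** transpose A) *v y)"
      by (simp add: matrix_vector_mult_add_rdistrib inner_right_distrib)
    also have "\<dots> = - (x \<bullet> (D *v y))"
      unfolding eq by (simp add: matrix_vector_mult_def inner_vec_def sum_negf)
    finally show ?thesis .
  qed
  have dissipative: "(transpose A *v x) \<bullet> (S *v x) < 0" if "x \<noteq> 0" for x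
  proof -
    have "x \<bullet> (D *v x) > 0" using that D by (simp add: PDD_def PD_def)
    then show ?thesis using form[of x x] sym[of x "transpose A *v x"] by linarith
  qed
  have cross: "x \<bullet> (D *v y) = 0" if "x \<in> V P" "y \<in> V Q" for x y
  proof -
    have "x $ k * (D $ k $ l * y $ l) = 0" for k l
    proof (cases "k = l")
      case True
      then show ?thesis using that PQ by (auto simp: V_def)
    next
      case False
      then show ?thesis using D by (simp add: PDD_def)
    qed
    then show ?thesis
      unfolding inner_vec_def matrix_vector_mult_def inner_real_def vec_lambda_beta sum_distrib_left
      by (auto intro!: sum.neutral)
  qed
  have "axis i 1 \<bullet> (S *v axis j 1) = 0"
  proof (rule orthogonal_invariant_subspaces
      [where S = "(*v) S" and T = "(*v) (transpose A)" and U = "V P" and W = "V Q"])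
    show "linear ((*v) S)" by (rule matrix_vector_mul_linear)
    show "axis i 1 \<in> V P" "axis j 1 \<in> V Q"
      by (auto simp: V_def P_def Q_def axis_def)
    show "(transpose A *v x) \<bullet> (S *v y) + x \<bullet> (S *v (transpose A *v y)) = 0"
      if "x \<in> V P" "y \<in> V Q" for x y
      using form[of x y] cross[OF that] by linarith
  qed (use S V sym dissipative invariant in \<open>auto simp: PD_def P_def Q_def\<close>)
  then show ?thesis
    by (simp add: matrix_vector_mul_component inner_axis' inner_axis)
qed

section \<open>Cancelling the edge by a positive combination\<close>

lemma PDD_combination:
  assumes "D1 \<in> PDD" "D2 \<in> PDD" "a > 0" "b > 0"
  shows "a *\<^sub>R D1 + b *\<^sub>R D2 \<in> PDD"
proof -
  have "x \<bullet> ((a *\<^sub>R D1 + b *\<^sub>R D2) *v x) > 0" if "x \<noteq> 0" for x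
  proof -
    have "x \<bullet> ((a *\<^sub>R D1 + b *\<^sub>R D2) *v x) = a * (x \<bullet> (D1 *v x)) + b * (x \<bullet> (D2 *v x))"
      by (simp add: matrix_vector_mult_add_rdistrib scaleR_matrix_vector_assoc[symmetric]
          inner_right_distrib)
    then show ?thesis
      using assms that by (auto simp: PDD_def PD_def intro!: add_pos_pos)
  qed
  moreover have "transpose (a *\<^sub>R D1 + b *\<^sub>R D2) = a *\<^sub>R D1 + b *\<^sub>R D2"
    using assms by (simp add: PDD_def PD_def transpose_def vec_eq_iff)
  ultimately show ?thesis
    using assms by (simp add: PDD_def PD_def)
qed

lemma lyapunov_combination:
  fixes S :: "real ^ 'n::finite ^ 'n"
  assumes "A1 ** S + S ** transpose A1 = - D1" "A2 ** S + S ** transpose A2 = - D2"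
  shows "(a *\<^sub>R A1 + b *\<^sub>R A2) ** S + S ** transpose (a *\<^sub>R A1 + b *\<^sub>R A2)
    = - (a *\<^sub>R D1 + b *\<^sub>R D2)"
proof -
  have "(a *\<^sub>R A1 + b *\<^sub>R A2) ** S + S ** transpose (a *\<^sub>R A1 + b *\<^sub>R A2)
      = a *\<^sub>R (A1 ** S + S ** transpose A1) + b *\<^sub>R (A2 ** S + S ** transpose A2)"
    by (simp add: vec_eq_iff matrix_matrix_mult_def transpose_def sum.distrib sum_distrib_left
        algebra_simps)
  then show ?thesis unfolding assms by simp
qed

theorem theorem4p5:
  fixes E E' :: "'n::finite rel" and e :: "'n \<times> 'n"
  assumes "e \<in> E"
    and "M_p E e \<noteq> {}"
    and "E' = E - {e}"
    and "\<exists>i j. An E' i \<inter> An E' j = {} \<and> An E i \<inter> An E j \<noteq> {}"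
  shows "sign_identifiable E e"
proof -
  have False if plus: "S \<in> M_plus E e" and minus: "S \<in> M_minus E e" for S
  proof -
    obtain i j where ij: "An E' i \<inter> An E' j = {}" "An E i \<inter> An E j \<noteq> {}"
      using assms(4) by blast
    have S: "S \<in> PD" "S $ i $ j \<noteq> 0"
      using plus ij(2) by (auto simp: M_plus_def M_sign_def faithful_cov_def)
    obtain A1 D1 where 1: "D1 \<in> PDD" "A1 ** S + S ** transpose A1 = - D1" "supp A1 = E"
      "sgn (edge_entry A1 e) = 1"
      using plus by (auto simp: M_plus_def M_sign_def)
    obtain A2 D2 where 2: "D2 \<in> PDD" "A2 ** S + S ** transpose A2 = - D2" "supp A2 = E"
      "sgn (edge_entry A2 e) = -1"
      using minus by (auto simp: M_minus_def M_sign_def)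
    \<comment> \<open>The weights are chosen so that the two entries at \<open>e\<close> cancel.\<close>
    define a b where "a = - edge_entry A2 e" and "b = edge_entry A1 e"
    have ab: "a > 0" "b > 0"
      using 1(4) 2(4) by (simp_all add: a_def b_def sgn_1_pos sgn_1_neg)
    have entry: "edge_entry (a *\<^sub>R A1 + b *\<^sub>R A2) f = a * edge_entry A1 f + b * edge_entry A2 f" for f
      by (simp add: edge_entry_def)
    have "edge_entry (a *\<^sub>R A1 + b *\<^sub>R A2) e = 0"
      unfolding entry by (simp add: a_def b_def)
    then have "supp (a *\<^sub>R A1 + b *\<^sub>R A2) \<subseteq> E'"
      using 1(3) 2(3) entry unfolding assms(3) supp_def by fastforce
    from no_common_ancestor_imp_zero_cov[OF S(1) PDD_combination[OF 1(1) 2(1) ab]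
        lyapunov_combination[OF 1(2) 2(2)] this ij(1)] S(2)
    show False by simp
  qed
  then show ?thesis
    using assms(2) by (auto simp: sign_identifiable_def M_p_def)
qed

end
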